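(* Let $1 < p < \infty$ and let $\mathcal{M} \subset \mathbb{R}^2$ be infinite. Then $\chi(\mathbb{R}^2, \ell_p, \mathcal{M}) = 2$. In other words, there exists a two-colouring of the plane $\mathbb{R}^2$ such that no $\ell_p$-isometric copy of $\mathcal{M}$ is monochromatic.
   Context: For $\mathbf{x} = (x_1, x_2) \in \mathbb{R}^2$ and $1 \le p < \infty$, the $\ell_p$-norm is $\|\mathbf{x}\|_p = (|x_1|^p + |x_2|^p)^{1/p}$. Given a subset $\mathcal{M} \subset \mathbb{R}^2$, a set $\mathcal{M}' \subset \mathbb{R}^2$ is called an $\ell_p$-isometric copy of $\mathcal{M}$ if there exists a bijection $f : \mathcal{M} \to \mathcal{M}'$ such that $\|\mathbf{x}-\mathbf{y}\|_p = \|f(\mathbf{x})-f(\mathbf{y})\|_p$ for all $\mathbf{x}, \mathbf{y} \in \mathcal{M}$. The chromatic number $\chi(\mathbb{R}^2, \ell_p, \mathcal{M})$ is the minimum number of colours needed to colour all points of $\mathbb{R}^2$ such that no $\ell_p$-isometric copy of $\mathcal{M}$ is monochromatic (i.e. has all its points of the same colour). *)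

theory Defs
  imports "HOL-Analysis.Analysis" "HOL-Library.Extended_Nat"
begin

definition lp_norm :: "real \<Rightarrow> real ^ 2 \<Rightarrow> real" where
  "lp_norm p x = (\<bar>x $ 1\<bar> powr p + \<bar>x $ 2\<bar> powr p) powr (1 / p)"

definition lp_isometric_copy :: "real \<Rightarrow> (real ^ 2) set \<Rightarrow> (real ^ 2) set \<Rightarrow> bool" where
  "lp_isometric_copy p M M' \<longleftrightarrow>
     (\<exists>f. bij_betw f M M' \<and> (\<forall>x\<in>M. \<forall>y\<in>M. lp_norm p (x - y) = lp_norm p (f x - f y)))"

definition monochromatic :: "('a \<Rightarrow> 'c) \<Rightarrow> 'a set \<Rightarrow> bool" where
  "monochromatic c S \<longleftrightarrow> (\<exists>a. \<forall>x\<in>S. c x = a)"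

definition avoids_monochromatic_copies :: "real \<Rightarrow> (real ^ 2) set \<Rightarrow> (real ^ 2 \<Rightarrow> 'c) \<Rightarrow> bool" where
  "avoids_monochromatic_copies p M c \<longleftrightarrow>
     \<not> (\<exists>M'. lp_isometric_copy p M M' \<and> monochromatic c M')"

text \<open>
  The value is \<open>\<infinity>\<close> (the infimum of the empty set) if no finite number of colours suffices;
  otherwise the infimum is attained, so it is a minimum.
\<close>

definition lp_chromatic_number :: "real \<Rightarrow> (real ^ 2) set \<Rightarrow> enat" where
  "lp_chromatic_number p M =
     Inf {enat k | k. \<exists>c :: real ^ 2 \<Rightarrow> nat. range c \<subseteq> {..<k} \<and> avoids_monochromatic_copies p M c}"

end

theory Submission
  imports Defs
begin

text \<open>
  Two circles with different centres in a strictly convex plane meet in finitely many points. Hence,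
  for an injective sequence \<open>x\<close> in \<open>M\<close>, an isometric copy \<open>f\<close> of \<open>x\<close> with \<open>f i = a\<close> and \<open>f j = b\<close>
  prescribed has finitely many options for each \<open>f n\<close>, and each point is an option for only finitely
  many \<open>n\<close>. A family of sequences with these two properties is two-coloured by induction on the
  cardinality of the ground set \<open>X\<close>. If \<open>X\<close> is countable, one treats the countably many
  \<open>(i, j, a, b)\<close> one after the other and gives a fresh set of options each colour. If \<open>X\<close> is
  uncountable, it is exhausted by a chain of smaller sets that contain every option given by two of
  their points; a sequence then lies, up to one term, in the difference of a member of the chain and
  the union of the earlier ones, and these differences are coloured by induction.
\<close>

section \<open>Circles in strictly convex planes\<close>

text \<open>The determinant of the two vectors: its sign tells on which side of the line through
  \<open>0\<close> and \<open>x\<close> the point \<open>y\<close> lies, and it vanishes exactly for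
  linearly dependent vectors.\<close>

definition cross2 :: "real ^ 2 \<Rightarrow> real ^ 2 \<Rightarrow> real" where
  "cross2 x y = x $ 1 * y $ 2 - x $ 2 * y $ 1"

lemma cross2_simps:
  "cross2 x (y + z) = cross2 x y + cross2 x z" "cross2 x (y - z) = cross2 x y - cross2 x z"
  "cross2 (x + y) z = cross2 x z + cross2 y z" "cross2 (x - y) z = cross2 x z - cross2 y z"
  "cross2 x (- y) = - cross2 x y" "cross2 (- x) y = - cross2 x y"
  "cross2 x (c *\<^sub>R y) = c * cross2 x y" "cross2 (c *\<^sub>R x) y = c * cross2 x y"
  "cross2 x x = 0"
  by (auto simp: cross2_def algebra_simps)

lemma cross2_commute: "cross2 x y = - cross2 y x"
  by (simp add: cross2_def)

lemma cross2_eq_0D: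
  assumes "cross2 v z = 0" "v \<noteq> 0"
  obtains c where "z = c *\<^sub>R v"
proof -
  have "v $ 1 \<noteq> 0 \<or> v $ 2 \<noteq> 0"
    using assms(2) by (auto simp: vec_eq_iff forall_2)
  then show ?thesis
  proof
    assume "v $ 1 \<noteq> 0"
    then show ?thesis
      using assms(1) by (intro that[of "z $ 1 / v $ 1"])
        (auto simp: vec_eq_iff forall_2 cross2_def field_simps)
  next
    assume "v $ 2 \<noteq> 0"
    then show ?thesis
      using assms(1) by (intro that[of "z $ 2 / v $ 2"])
        (auto simp: vec_eq_iff forall_2 cross2_def field_simps)
  qed
qed

text \<open>A norm whose unit circle contains no segment; \<open>strict\<close> expresses this
  through the equality case of the triangle inequality.\<close>

locale strictly_convex_plane =
  fixes N :: "real ^ 2 \<Rightarrow> real"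
  assumes pos: "x \<noteq> 0 \<Longrightarrow> 0 < N x"
    and scale: "N (c *\<^sub>R x) = \<bar>c\<bar> * N x"
    and triangle: "N (x + y) \<le> N x + N y"
    and strict: "N (x + y) = N x + N y \<Longrightarrow> cross2 x y = 0"
begin

lemma minus: "N (- x) = N x"
  using scale[of "-1" x] by simp

lemma minus_commute: "N (x - y) = N (y - x)"
  using minus[of "x - y"] by simp

text \<open>Here the segment from \<open>0\<close> to \<open>z\<close> crosses the segment from \<open>v\<close> to \<open>w\<close> in a point \<open>q\<close>:
  the diagonals of a quadrilateral are together longer than two opposite sides.\<close>

lemma equidistant_crossing:
  assumes w: "w = l *\<^sub>R z - m *\<^sub>R v" and "0 < m" "0 \<le> l" "l \<le> 1"
    and "N w = N z" "N (w - v) = N (z - v)"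
  shows "cross2 v z = 0"
proof -
  \<comment> \<open>Dividing \<open>l *\<^sub>R z = w + m *\<^sub>R v\<close> by
    \<open>1 + m\<close> gives a point on both segments.\<close>
  define q where "q = (l / (1 + m)) *\<^sub>R z"
  have q: "q = (1 / (1 + m)) *\<^sub>R (w + m *\<^sub>R v)"
    using assms(2) by (simp add: q_def w)
  have wq: "w - q = (m / (1 + m)) *\<^sub>R (w - v)" and qv: "q - v = (1 / (1 + m)) *\<^sub>R (w - v)"
    using assms(2) unfolding q by (simp_all add: vec_eq_iff divide_simps) (simp_all add: algebra_simps)
  have zq: "z - q = (1 - l / (1 + m)) *\<^sub>R z"
    by (simp add: q_def algebra_simps)
  have l1: "l / (1 + m) < 1" using assms by simp
  have "N w \<le> N q + N (w - q)" using triangle[of q "w - q"] by simp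
  also have "\<dots> = l / (1 + m) * N z + m / (1 + m) * N (w - v)"
    unfolding wq using assms by (simp add: q_def scale)
  finally have 1: "N w \<le> l / (1 + m) * N z + m / (1 + m) * N (w - v)" .
  have 2: "N (z - v) \<le> N (z - q) + N (q - v)" using triangle[of "z - q" "q - v"] by simp
  have 3: "N (z - q) + N (q - v) = (1 - l / (1 + m)) * N z + 1 / (1 + m) * N (w - v)"
    unfolding zq qv using assms l1 by (simp add: scale)
  have "m / (1 + m) * N (w - v) = N (w - v) - 1 / (1 + m) * N (w - v)"
    using assms(2) by (simp add: field_simps)
  moreover have "(1 - l / (1 + m)) * N z = N z - l / (1 + m) * N z"
    by (simp add: left_diff_distrib)
  \<comment> \<open>\<open>1\<close> and \<open>2\<close> add up to
    \<open>N w + N (z - v) \<le> N z + N (w - v)\<close>. By hypothesis both sides agree, so both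
    inequalities are equalities.\<close>
  ultimately have "N (z - v) = N (z - q) + N (q - v)"
    using 1 2 3 assms(5,6) by linarith
  then have "N ((z - q) + (q - v)) = N (z - q) + N (q - v)"
    by simp
  from strict[OF this] have "(1 - l / (1 + m)) * cross2 z v = 0"
    unfolding zq by (simp add: q_def cross2_simps)
  then show ?thesis
    using l1 cross2_commute[of z v] by (metis diff_gt_0_iff_gt less_irrefl mult_eq_0_iff neg_equal_0_iff_equal)
qed

text \<open>Measured from the line through \<open>0\<close> and \<open>v\<close>, \<open>w\<close>
  is at most as high as \<open>z\<close>. Either \<open>w\<close> lies beyond one of the two edges
  at \<open>z\<close> of the triangle \<open>0\<close>, \<open>v\<close>, \<open>z\<close>, and a
  crossing quadrilateral makes the triangle degenerate; or \<open>w\<close> lies in the triangle,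
  where every point but \<open>z\<close> has a smaller sum of distances to \<open>0\<close> and
  \<open>v\<close>.\<close>

lemma equidistant_same_side:
  assumes "v \<noteq> 0" "cross2 v z \<noteq> 0" and l: "cross2 v w = l * cross2 v z" "0 \<le> l" "l \<le> 1"
    and eq: "N w = N z" "N (w - v) = N (z - v)"
  shows "w = z"
proof -
  have "cross2 v (w - l *\<^sub>R z) = 0"
    using l by (simp add: cross2_simps)
  then obtain k where "w - l *\<^sub>R z = k *\<^sub>R v"
    using cross2_eq_0D assms(1) by blast
  then have w: "w = l *\<^sub>R z + k *\<^sub>R v" by (simp add: algebra_simps)
  \<comment> \<open>At height \<open>l\<close> the triangle is cut in the points with
    \<open>0 \<le> k \<le> 1 - l\<close>.\<close>
  consider "k < 0" | "k > 1 - l" | "0 \<le> k" "k \<le> 1 - l" by linarith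
  then show ?thesis
  proof cases
    case 1
    then have "cross2 v z = 0"
      using l eq w by (intro equidistant_crossing[of w l z "- k" v]) auto
    with assms(2) show ?thesis by simp
  next
    case 2
    \<comment> \<open>The mirror image of the first case: translation by \<open>- v\<close>
      exchanges the roles of \<open>0\<close> and \<open>v\<close>.\<close>
    have "cross2 (- v) (z - v) = 0"
      using 2 l eq by (intro equidistant_crossing[of "w - v" l "z - v" "k + l - 1" "- v"])
        (auto simp: w algebra_simps)
    with assms(2) show ?thesis by (simp add: cross2_simps)
  next
    case 3
    have "N w \<le> l * N z + k * N v"
      using triangle[of "l *\<^sub>R z" "k *\<^sub>R v"] 3 l by (simp add: w scale)
    moreover have "w - v = l *\<^sub>R (z - v) + (1 - l - k) *\<^sub>R (- v)"
      by (simp add: w algebra_simps)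
    then have "N (w - v) \<le> l * N (z - v) + (1 - l - k) * N v"
      using triangle[of "l *\<^sub>R (z - v)" "(1 - l - k) *\<^sub>R (- v)"] 3 l
      by (simp add: scale minus del: scaleR_minus_right)
    \<comment> \<open>The sum of the two bounds; the coefficients of \<open>N v\<close> add up to
      \<open>1 - l\<close>.\<close>
    ultimately have "(1 - l) * (N z + N (z - v)) \<le> (1 - l) * N v"
      using eq by (simp add: algebra_simps)
    moreover have "N v < N z + N (z - v)"
    proof -
      have "N (z + (v - z)) \<noteq> N z + N (v - z)"
        using strict[of z "v - z"] assms(2) cross2_commute[of z v] by (auto simp: cross2_simps)
      then show ?thesis
        using triangle[of z "v - z"] minus_commute[of v z] by simp
    qed
    ultimately have "l = 1"
      using l(3) by (metis diff_gt_0_iff_gt linorder_not_less mult_less_cancel_left_pos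
          order_le_less)
    with 3 show ?thesis by (simp add: w)
  qed
qed

text \<open>Off the line through \<open>0\<close> and \<open>v\<close>, whichever of the two points
  is nearer to the line takes the lower position in \<open>equidistant_same_side\<close>.\<close>

lemma equidistant_eq:
  assumes "v \<noteq> 0" and sgn: "sgn (cross2 v z) = sgn (cross2 v w)"
    and eq: "N w = N z" "N (w - v) = N (z - v)"
  shows "w = z"
proof (cases "cross2 v z = 0")
  case True
  then obtain a b where ab: "z = a *\<^sub>R v" "w = b *\<^sub>R v"
    using sgn cross2_eq_0D[OF _ assms(1)] by (metis sgn_0_0)
  have "z - v = (a - 1) *\<^sub>R v" "w - v = (b - 1) *\<^sub>R v"
    by (auto simp: ab algebra_simps)
  then have "\<bar>a\<bar> = \<bar>b\<bar>" "\<bar>a - 1\<bar> = \<bar>b - 1\<bar>"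
    using eq pos[OF assms(1)] by (auto simp: ab scale)
  then have "a = b" by linarith
  then show ?thesis by (simp add: ab)
next
  case False
  then have w0: "cross2 v w \<noteq> 0" using sgn by (metis sgn_0_0)
  show ?thesis
  proof (cases "\<bar>cross2 v w\<bar> \<le> \<bar>cross2 v z\<bar>")
    case True
    then show ?thesis
      using False w0 sgn eq assms(1)
      by (intro equidistant_same_side[of v z w "cross2 v w / cross2 v z"])
        (auto simp: sgn_real_def divide_simps split: if_splits)
  next
    case *: False
    have "z = w"
      using False w0 sgn eq assms(1) *
      by (intro equidistant_same_side[of v w z "cross2 v z / cross2 v w"])
        (auto simp: sgn_real_def divide_simps split: if_splits)
    then show ?thesis ..
  qed
qed

text \<open>There is at most one common point on either side of the line through the centres and at
  most one on it.\<close>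

lemma finite_circle_Int:
  assumes "a \<noteq> b"
  shows "finite {z. N (z - a) = r \<and> N (z - b) = s}"
proof -
  have "inj_on (\<lambda>z. sgn (cross2 (b - a) (z - a))) {z. N (z - a) = r \<and> N (z - b) = s}"
  proof (rule inj_onI)
    fix z w
    assume *: "z \<in> {z. N (z - a) = r \<and> N (z - b) = s}" "w \<in> {z. N (z - a) = r \<and> N (z - b) = s}"
      "sgn (cross2 (b - a) (z - a)) = sgn (cross2 (b - a) (w - a))"
    then have "w - a = z - a"
      using assms by (intro equidistant_eq[of "b - a"]) auto
    then show "z = w" by simp
  qed
  moreover have "range (\<lambda>z. sgn (cross2 (b - a) (z - a))) \<subseteq> {-1, 0, 1}"
    by (auto simp: sgn_real_def)
  ultimately show ?thesis
    by (meson finite.emptyI finite.insertI finite_subset image_mono inj_on_finite subset_UNIV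
        subset_trans)
qed

end

section \<open>The \<open>\<ell>\<^sub>p\<close>-norm is strictly convex\<close>

text \<open>The graph lies strictly above its tangent at \<open>m\<close>, by the mean value theorem
  and the strictly increasing derivative. At \<open>t = 0\<close> only continuity of the power is
  used.\<close>

lemma powr_tangent_less:
  fixes p :: real
  assumes "1 < p" "0 \<le> t" "0 < m" "t \<noteq> m"
  shows "m powr p + p * m powr (p - 1) * (t - m) < t powr p"
proof -
  have D: "((\<lambda>x. x powr p) has_real_derivative p * x powr (p - 1)) (at x)" if "0 < x" for x
    using that by (auto intro!: derivative_eq_intros)
  have C: "continuous_on {a..b} (\<lambda>x. x powr p)" if "0 \<le> a" for a b
    using that assms(1) by (intro continuous_on_powr' continuous_intros) auto
  have mvt: "\<exists>x. a < x \<and> x < b \<and> b powr p - a powr p = (b - a) * (p * x powr (p - 1))"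
    if "0 \<le> a" "a < b" for a b
  proof -
    have "\<exists>l z. a < z \<and> z < b \<and> DERIV (\<lambda>x. x powr p) z :> l \<and> b powr p - a powr p = (b - a) * l"
      using that D by (intro MVT C) (auto simp: real_differentiable_def, meson le_less_trans)
    then obtain l z where "a < z" "z < b" "DERIV (\<lambda>x. x powr p) z :> l"
      "b powr p - a powr p = (b - a) * l" by blast
    with D[of z] that show ?thesis
      by (metis DERIV_unique le_less_trans)
  qed
  show ?thesis
  proof (cases "t < m")
    case True
    then obtain x where x: "t < x" "x < m" "m powr p - t powr p = (m - t) * (p * x powr (p - 1))"
      using mvt assms by blast
    have "x powr (p - 1) < m powr (p - 1)"
      using x assms by (intro powr_less_mono2) auto
    then have "(m - t) * (p * x powr (p - 1)) < (m - t) * (p * m powr (p - 1))"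
      using True assms by simp
    with x show ?thesis by (simp add: algebra_simps)
  next
    case False
    with assms obtain x where x: "m < x" "x < t" "t powr p - m powr p = (t - m) * (p * x powr (p - 1))"
      using mvt[of m t] by auto
    have "m powr (p - 1) < x powr (p - 1)"
      using x assms by (intro powr_less_mono2) auto
    then have "(t - m) * (p * m powr (p - 1)) < (t - m) * (p * x powr (p - 1))"
      using False assms by simp
    with x show ?thesis by (simp add: algebra_simps)
  qed
qed

text \<open>Strictness has two sources: if \<open>\<bar>s\<bar> = \<bar>t\<bar>\<close>, the signs
  are opposite and the terms partly cancel; otherwise the tangent inequality at the mean of the
  absolute values is strict.\<close>

lemma abs_powr_strict_convex:
  fixes p :: real
  assumes "1 < p" "0 < u" "0 < v" "u + v = 1" "s \<noteq> t"
  shows "\<bar>u * s + v * t\<bar> powr p < u * \<bar>s\<bar> powr p + v * \<bar>t\<bar> powr p"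
proof -
  define m where "m = u * \<bar>s\<bar> + v * \<bar>t\<bar>"
  have m: "0 < m"
  proof -
    have "s \<noteq> 0 \<or> t \<noteq> 0" using assms(5) by auto
    then have "0 < u * \<bar>s\<bar> \<or> 0 < v * \<bar>t\<bar>"
      using mult_pos_pos[OF assms(2), of "\<bar>s\<bar>"] mult_pos_pos[OF assms(3), of "\<bar>t\<bar>"] by auto
    moreover have "0 \<le> u * \<bar>s\<bar>" "0 \<le> v * \<bar>t\<bar>" using assms by auto
    ultimately show ?thesis unfolding m_def by linarith
  qed
  have le: "\<bar>u * s + v * t\<bar> \<le> m"
    unfolding m_def using assms abs_triangle_ineq[of "u * s" "v * t"] by (simp add: abs_mult)
  show ?thesis
  proof (cases "\<bar>s\<bar> = \<bar>t\<bar>")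
    case True
    with assms have t: "t = - s" "s \<noteq> 0" by auto
    have ms: "m = \<bar>s\<bar>" using assms by (simp add: m_def t flip: distrib_right)
    have "\<bar>u - v\<bar> < 1" using assms by linarith
    then have "\<bar>u - v\<bar> * \<bar>s\<bar> < \<bar>s\<bar>" using t by simp
    moreover have "u * s + v * t = (u - v) * s" by (simp add: t algebra_simps)
    ultimately have "\<bar>u * s + v * t\<bar> < \<bar>s\<bar>" by (simp add: abs_mult)
    then have "\<bar>u * s + v * t\<bar> powr p < \<bar>s\<bar> powr p"
      using assms by (intro powr_less_mono2) auto
    then show ?thesis using assms by (simp add: t flip: distrib_right)
  next
    case False
    have s: "\<bar>s\<bar> \<noteq> m"
    proof
      assume "\<bar>s\<bar> = m"
      then have "(u + v) * \<bar>s\<bar> = u * \<bar>s\<bar> + v * \<bar>t\<bar>" using assms by (simp add: m_def)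
      then have "v * \<bar>s\<bar> = v * \<bar>t\<bar>" by (simp add: algebra_simps)
      then show False using False assms by simp
    qed
    have t: "\<bar>t\<bar> \<noteq> m"
    proof
      assume "\<bar>t\<bar> = m"
      then have "(u + v) * \<bar>t\<bar> = u * \<bar>s\<bar> + v * \<bar>t\<bar>" using assms by (simp add: m_def)
      then have "u * \<bar>t\<bar> = u * \<bar>s\<bar>" by (simp add: algebra_simps)
      then show False using False assms by simp
    qed
    let ?T = "p * m powr (p - 1)"
    have "u * (m powr p + ?T * (\<bar>s\<bar> - m)) < u * \<bar>s\<bar> powr p"
      using powr_tangent_less[OF assms(1) _ m s] assms by simp
    moreover have "v * (m powr p + ?T * (\<bar>t\<bar> - m)) < v * \<bar>t\<bar> powr p"
      using powr_tangent_less[OF assms(1) _ m t] assms by simp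
    \<comment> \<open>The weighted slope terms cancel because \<open>m\<close> is the weighted mean
      of \<open>\<bar>s\<bar>\<close> and \<open>\<bar>t\<bar>\<close>.\<close>
    moreover have "u * (m powr p + ?T * (\<bar>s\<bar> - m)) + v * (m powr p + ?T * (\<bar>t\<bar> - m)) =
      (u + v) * m powr p + ?T * ((u * \<bar>s\<bar> + v * \<bar>t\<bar>) - (u + v) * m)"
      by (simp add: algebra_simps)
    moreover have "\<dots> = m powr p"
      using assms(4) by (simp flip: m_def)
    moreover have "\<bar>u * s + v * t\<bar> powr p \<le> m powr p"
      using le assms by (intro powr_mono2) auto
    ultimately show ?thesis by linarith
  qed
qed

section \<open>Basic properties and strict convexity of \<open>lp_norm\<close> on the plane\<close>

lemma lp_norm_powr: "p \<noteq> 0 \<Longrightarrow> lp_norm p x powr p = \<bar>x $ 1\<bar> powr p + \<bar>x $ 2\<bar> powr p"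
  by (simp add: lp_norm_def powr_powr)

lemma lp_norm_nonneg: "0 \<le> lp_norm p x"
  by (simp add: lp_norm_def)

lemma lp_norm_pos: "x \<noteq> 0 \<Longrightarrow> 0 < lp_norm p x"
  by (auto simp: lp_norm_def vec_eq_iff forall_2 add_nonneg_eq_0_iff)

lemma lp_norm_0: "lp_norm p 0 = 0"
  by (simp add: lp_norm_def)

lemma lp_norm_scale: "p \<noteq> 0 \<Longrightarrow> lp_norm p (c *\<^sub>R x) = \<bar>c\<bar> * lp_norm p x"
  by (simp add: lp_norm_def abs_mult powr_mult powr_powr flip: distrib_left)

text \<open>Convexity of the power is applied in each coordinate, and it is strict in a coordinate
  where \<open>x\<close> and \<open>y\<close> differ.\<close>

lemma lp_norm_strict_convex:
  assumes "1 < p" "lp_norm p x = 1" "lp_norm p y = 1" "0 < u" "0 < v" "u + v = 1" "x \<noteq> y"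
  shows "lp_norm p (u *\<^sub>R x + v *\<^sub>R y) < 1"
proof -
  have conv: "\<bar>u * s + v * t\<bar> powr p \<le> u * \<bar>s\<bar> powr p + v * \<bar>t\<bar> powr p" for s t
    using abs_powr_strict_convex[OF assms(1,4,5,6), of s t] assms(6)
    by (cases "s = t") (auto simp flip: distrib_right)
  have one: "\<bar>x $ 1\<bar> powr p + \<bar>x $ 2\<bar> powr p = 1" "\<bar>y $ 1\<bar> powr p + \<bar>y $ 2\<bar> powr p = 1"
    using lp_norm_powr[of p x] lp_norm_powr[of p y] assms by auto
  have "x $ 1 \<noteq> y $ 1 \<or> x $ 2 \<noteq> y $ 2"
    using assms(7) by (auto simp: vec_eq_iff forall_2)
  then have "\<bar>u * x $ 1 + v * y $ 1\<bar> powr p + \<bar>u * x $ 2 + v * y $ 2\<bar> powr p <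
    (u * \<bar>x $ 1\<bar> powr p + v * \<bar>y $ 1\<bar> powr p) + (u * \<bar>x $ 2\<bar> powr p + v * \<bar>y $ 2\<bar> powr p)"
    using abs_powr_strict_convex[OF assms(1,4,5,6)] conv
    by (metis add_less_le_mono add_le_less_mono)
  also have "\<dots> = u * (\<bar>x $ 1\<bar> powr p + \<bar>x $ 2\<bar> powr p) + v * (\<bar>y $ 1\<bar> powr p + \<bar>y $ 2\<bar> powr p)"
    by (simp add: algebra_simps)
  also have "\<dots> = 1"
    using assms(6) by (simp add: one)
  finally have "lp_norm p (u *\<^sub>R x + v *\<^sub>R y) powr p < 1 powr p"
    using assms(1) by (simp add: lp_norm_powr)
  then show ?thesis
    using powr_less_cancel2[of p "lp_norm p (u *\<^sub>R x + v *\<^sub>R y)" 1] assms(1)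
    by (cases "lp_norm p (u *\<^sub>R x + v *\<^sub>R y) = 0") (auto simp: lp_norm_nonneg less_le)
qed

lemma strictly_convex_plane_lp_norm:
  assumes p: "1 < p"
  shows "strictly_convex_plane (lp_norm p)"
proof -
  have main: "lp_norm p (x + y) < lp_norm p x + lp_norm p y" if "cross2 x y \<noteq> 0" for x y
  proof -
    let ?a = "lp_norm p x" and ?b = "lp_norm p y"
    have "x \<noteq> 0" "y \<noteq> 0" using that by (auto simp: cross2_def)
    then have ab: "0 < ?a" "0 < ?b" by (auto intro: lp_norm_pos)
    have "(1 / ?a) *\<^sub>R x \<noteq> (1 / ?b) *\<^sub>R y"
    proof
      assume "(1 / ?a) *\<^sub>R x = (1 / ?b) *\<^sub>R y"
      then have "cross2 ((1 / ?a) *\<^sub>R x) ((1 / ?b) *\<^sub>R y) = 0" by (simp add: cross2_simps)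
      then show False using that ab by (simp add: cross2_simps)
    qed
    \<comment> \<open>Weights proportional to the norms turn the combination of the normalised
      vectors into a multiple of \<open>x + y\<close>.\<close>
    then have "lp_norm p ((?a / (?a + ?b)) *\<^sub>R ((1 / ?a) *\<^sub>R x) +
        (?b / (?a + ?b)) *\<^sub>R ((1 / ?b) *\<^sub>R y)) < 1"
      using ab p by (intro lp_norm_strict_convex) (auto simp: lp_norm_scale simp flip: add_divide_distrib)
    also have "(?a / (?a + ?b)) *\<^sub>R ((1 / ?a) *\<^sub>R x) + (?b / (?a + ?b)) *\<^sub>R ((1 / ?b) *\<^sub>R y) =
        (1 / (?a + ?b)) *\<^sub>R (x + y)"
      using ab by (simp add: scaleR_add_right)
    finally show ?thesis
      using ab p by (simp add: lp_norm_scale)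
  qed
  have "lp_norm p (x + y) \<le> lp_norm p x + lp_norm p y" for x y
  proof (cases "x = 0 \<or> cross2 x y \<noteq> 0")
    case True
    then show ?thesis using main[of x y] by (auto simp: lp_norm_0)
  next
    case False
    then obtain c where y: "y = c *\<^sub>R x" using cross2_eq_0D by blast
    then have "x + y = (1 + c) *\<^sub>R x" by (simp add: algebra_simps)
    then have "lp_norm p (x + y) = \<bar>1 + c\<bar> * lp_norm p x"
      using p by (simp add: lp_norm_scale)
    also have "\<dots> \<le> (1 + \<bar>c\<bar>) * lp_norm p x"
      using lp_norm_nonneg[of p x] by (intro mult_right_mono) auto
    finally show ?thesis
      using p by (simp add: lp_norm_scale y algebra_simps)
  qed
  then show ?thesis
    using main p by unfold_locales (force simp: lp_norm_pos lp_norm_scale)+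
qed

section \<open>Two-colourings of families of sequences\<close>

definition closure_step :: "('a \<Rightarrow> 'a \<Rightarrow> nat \<Rightarrow> 'a) \<Rightarrow> 'a set \<Rightarrow> 'a set" where
  "closure_step g Y = Y \<union> (\<lambda>(a, b, n). g a b n) ` (Y \<times> Y \<times> UNIV)"

text \<open>The least superset of \<open>Y\<close> closed under all operations
  \<open>g _ _ n\<close>; as these are binary, the finite stages suffice.\<close>

definition generated :: "('a \<Rightarrow> 'a \<Rightarrow> nat \<Rightarrow> 'a) \<Rightarrow> 'a set \<Rightarrow> 'a set" where
  "generated g Y = (\<Union>n. (closure_step g ^^ n) Y)"

lemma generated_base: "Y \<subseteq> generated g Y"
  unfolding generated_def using UN_upper[of 0 UNIV "\<lambda>n. (closure_step g ^^ n) Y"] by simp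

lemma generated_mono:
  assumes "Y \<subseteq> Z"
  shows "generated g Y \<subseteq> generated g Z"
proof -
  have "(closure_step g ^^ n) Y \<subseteq> (closure_step g ^^ n) Z" for n
  proof (induction n)
    case (Suc n)
    have "closure_step g A \<subseteq> closure_step g B" if "A \<subseteq> B" for A B
      unfolding closure_step_def using that by (intro Un_mono image_mono Sigma_mono) auto
    with Suc show ?case by simp
  qed (simp add: assms)
  then show ?thesis unfolding generated_def by blast
qed

lemma generated_closed:
  assumes "a \<in> generated g Y" "b \<in> generated g Y"
  shows "g a b n \<in> generated g Y"
proof -
  obtain i j where ij: "a \<in> (closure_step g ^^ i) Y" "b \<in> (closure_step g ^^ j) Y"
    using assms by (auto simp: generated_def)
  have "incseq (\<lambda>n. (closure_step g ^^ n) Y)"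
    by (rule incseq_SucI) (auto simp: closure_step_def)
  then have "a \<in> (closure_step g ^^ max i j) Y" "b \<in> (closure_step g ^^ max i j) Y"
    using ij by (meson incseqD max.cobounded1 max.cobounded2 subsetD)+
  then have "g a b n \<in> closure_step g ((closure_step g ^^ max i j) Y)"
    unfolding closure_step_def by force
  then have "g a b n \<in> (closure_step g ^^ Suc (max i j)) Y"
    by simp
  then show ?thesis unfolding generated_def by blast
qed

text \<open>The summand \<open>nat\<close> keeps the bound infinite even for finite
  \<open>Y\<close>, so that it absorbs the products at each stage and the countable union.\<close>

lemma card_of_generated:
  includes cardinal_syntax
  shows "|generated g Y| \<le>o |Y <+> (UNIV :: nat set)|"
proof -
  let ?K = "Y <+> (UNIV :: nat set)"
  have inf: "infinite ?K" by simp
  then have inf': "infinite (Field |?K| )" by (simp add: Field_card_of)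
  have "|(closure_step g ^^ n) Y| \<le>o |?K|" for n
  proof (induction n)
    case 0
    then show ?case by (simp add: card_of_Plus1)
  next
    case (Suc n)
    let ?Y = "(closure_step g ^^ n) Y"
    have "|?Y \<times> ?Y \<times> (UNIV :: nat set)| \<le>o |?K|"
      by (intro card_of_Times_ordLeq_infinite_Field[OF inf'] Suc card_of_Plus2 card_of_Card_order)
    then have "|(\<lambda>(a, b, n). g a b n) ` (?Y \<times> ?Y \<times> UNIV)| \<le>o |?K|"
      using card_of_image ordLeq_transitive by blast
    then have "|closure_step g ?Y| \<le>o |?K|"
      unfolding closure_step_def[of g ?Y]
      by (rule card_of_Un_ordLeq_infinite_Field[OF inf' Suc _ card_of_Card_order])
    then show ?case by simp
  qed
  then show ?thesis
    unfolding generated_def by (intro card_of_UNION_ordLeq_infinite inf card_of_Plus2) auto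
qed

text \<open>By \<open>thin\<close>, a finite set meets only finitely many \<open>Q k n\<close> for
  fixed \<open>k\<close>. So, whatever finite part is already coloured, some late
  \<open>Q k n\<close> avoids one colour and can be given the other. Asking for
  \<open>n \<ge> m\<close> serves sequences that are in the ground set only from some index
  on.\<close>

lemma greedy_two_colouring:
  fixes Q :: "nat \<Rightarrow> nat \<Rightarrow> 'a set"
  assumes fin: "\<And>k n. finite (Q k n)" and thin: "\<And>k x. finite {n. x \<in> Q k n}"
  shows "\<exists>C. \<forall>k m. (\<exists>n\<ge>m. Q k n \<subseteq> C) \<and> (\<exists>n\<ge>m. Q k n \<inter> C = {})"
proof -
  have ex: "\<exists>n\<ge>m. Q k n \<inter> S = {}" if "finite S" for S k m
  proof -
    have "finite (\<Union>x\<in>S. {n. x \<in> Q k n})" using that thin by blast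
    then have "finite ({..m} \<union> (\<Union>x\<in>S. {n. x \<in> Q k n}))" by blast
    then obtain n where "n \<notin> {..m} \<union> (\<Union>x\<in>S. {n. x \<in> Q k n})"
      using ex_new_if_finite infinite_UNIV_nat by blast
    then show ?thesis by (intro exI[of _ n]) auto
  qed
  \<comment> \<open>A state holds the finite sets of points coloured so far, one for each colour;
    step \<open>t\<close> treats the pair \<open>(k, m)\<close> that it encodes.\<close>
  let ?P = "\<lambda>(_ :: nat) (s :: 'a set \<times> 'a set). finite (fst s) \<and> finite (snd s) \<and> fst s \<inter> snd s = {}"
  let ?S = "\<lambda>t s s'. fst s \<subseteq> fst s' \<and> snd s \<subseteq> snd s' \<and>
    (\<exists>n\<ge>snd (prod_decode t). Q (fst (prod_decode t)) n \<subseteq> fst s') \<and>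
    (\<exists>n\<ge>snd (prod_decode t). Q (fst (prod_decode t)) n \<subseteq> snd s')"
  have "\<exists>f. \<forall>t. ?P t (f t) \<and> ?S t (f t) (f (Suc t))"
  proof (rule dependent_nat_choice)
    show "\<exists>s. ?P 0 s" by (intro exI[of _ "({}, {})"]) simp
  next
    fix s :: "'a set \<times> 'a set" and t
    assume *: "?P t s"
    obtain R B where s: "s = (R, B)" by force
    obtain k m where km: "prod_decode t = (k, m)" by force
    have "finite B" using * s by simp
    from ex[OF this, of m k] obtain n where n: "n \<ge> m" "Q k n \<inter> B = {}" by blast
    have "finite (R \<union> Q k n)" using * s fin by simp
    from ex[OF this, of m k] obtain n' where n': "n' \<ge> m" "Q k n' \<inter> (R \<union> Q k n) = {}" by blast
    show "\<exists>s'. ?P (Suc t) s' \<and> ?S t s s'"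
    proof (intro exI conjI)
      let ?s = "(R \<union> Q k n, B \<union> Q k n')"
      show "finite (fst ?s)" "finite (snd ?s)" "fst s \<subseteq> fst ?s" "snd s \<subseteq> snd ?s"
        using * fin by (simp_all add: s)
      show "fst ?s \<inter> snd ?s = {}"
        using * n n' by (simp add: s) blast
      show "n \<ge> snd (prod_decode t)" "Q (fst (prod_decode t)) n \<subseteq> fst ?s"
        "n' \<ge> snd (prod_decode t)" "Q (fst (prod_decode t)) n' \<subseteq> snd ?s"
        using n n' by (simp_all add: km)
    qed
  qed
  then obtain f where f_all: "\<forall>t. ?P t (f t) \<and> ?S t (f t) (f (Suc t))" ..
  have f: "?P t (f t)" "?S t (f t) (f (Suc t))" for t
    using conjunct1[OF spec[OF f_all, of t]] conjunct2[OF spec[OF f_all, of t]] .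
  have inc: "incseq (\<lambda>t. fst (f t))" "incseq (\<lambda>t. snd (f t))"
    unfolding incseq_Suc_iff using f(2) by simp_all
  have disj: "fst (f t) \<inter> snd (f u) = {}" for t u
  proof -
    have "fst (f t) \<subseteq> fst (f (max t u))" "snd (f u) \<subseteq> snd (f (max t u))"
      by (rule incseqD[OF inc(1)] incseqD[OF inc(2)], simp)+
    moreover have "fst (f (max t u)) \<inter> snd (f (max t u)) = {}"
      using f(1)[of "max t u"] by simp
    ultimately show ?thesis by blast
  qed
  show ?thesis
  proof (intro exI[of _ "\<Union>t. fst (f t)"] allI conjI)
    fix k m
    have *: "\<exists>n\<ge>m. Q k n \<subseteq> fst (f (Suc (prod_encode (k, m))))"
      "\<exists>n\<ge>m. Q k n \<subseteq> snd (f (Suc (prod_encode (k, m))))"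
      using f(2)[of "prod_encode (k, m)"] by simp_all
    show "\<exists>n\<ge>m. Q k n \<subseteq> (\<Union>t. fst (f t))" using *(1) by blast
    show "\<exists>n\<ge>m. Q k n \<inter> (\<Union>t. fst (f t)) = {}" using *(2) disj by blast
  qed
qed

text \<open>Finitely many terms outside \<open>X\<close> are allowed because the pieces of
  \<open>X\<close> to which the induction hypothesis is applied contain a sequence only up to
  finitely many terms.\<close>

lemma two_colouring_of_sequences_on:
  includes cardinal_syntax
  fixes F :: "(nat \<Rightarrow> 'a) set" and X :: "'a set"
  assumes fin: "\<And>i j a b n. i \<noteq> j \<Longrightarrow> finite {f n |f. f \<in> F \<and> f i = a \<and> f j = b}"
    and thin: "\<And>i j a b c. i \<noteq> j \<Longrightarrow> finite {n. \<exists>f\<in>F. f i = a \<and> f j = b \<and> f n = c}"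
  shows "\<exists>C. \<forall>f\<in>F. finite {n. f n \<notin> X} \<longrightarrow> (\<exists>n. f n \<in> X \<inter> C) \<and> (\<exists>n. f n \<in> X - C)"
proof (induction X rule: wf_induct_rule[OF wf_inv_image[OF wf_ordLess, of card_of]])
  case (1 X)
  have two: "\<exists>i j. i \<noteq> j \<and> f i \<in> X \<and> f j \<in> X" if fin_f: "finite {n. f n \<notin> X}" for f :: "nat \<Rightarrow> 'a"
  proof -
    obtain i where i: "i \<notin> {n. f n \<notin> X}"
      using ex_new_if_finite[OF infinite_UNIV_nat fin_f] by blast
    have "finite (insert i {n. f n \<notin> X})" using fin_f by simp
    then obtain j where "j \<notin> insert i {n. f n \<notin> X}"
      using ex_new_if_finite[OF infinite_UNIV_nat] by blast
    with i show ?thesis by auto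
  qed
  show ?case
  proof (cases "countable X")
    case True
    define T where "T = (UNIV :: nat set) \<times> (UNIV :: nat set) \<times> X \<times> X"
    have T: "countable T" unfolding T_def using True by blast
    \<comment> \<open>Nothing is assumed about equal positions; the empty set is a harmless value
      there.\<close>
    define Q where "Q k n = (case from_nat_into T k of (i, j, a, b) \<Rightarrow>
      if i = j then {} else {f n |f. f \<in> F \<and> f i = a \<and> f j = b})" for k n
    have "finite (Q k n)" for k n
      by (cases "from_nat_into T k") (simp add: Q_def fin)
    moreover have "finite {n. x \<in> Q k n}" for k x
    proof -
      obtain i j a b where k: "from_nat_into T k = (i, j, a, b)" by (metis prod.exhaust)
      show ?thesis
      proof (cases "i = j")
        case False
        then have "{n. x \<in> Q k n} \<subseteq> {n. \<exists>f\<in>F. f i = a \<and> f j = b \<and> f n = x}"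
          by (auto simp: Q_def k)
        then show ?thesis using thin[OF False] finite_subset by blast
      qed (auto simp: Q_def k)
    qed
    ultimately have "\<exists>C. \<forall>k m. (\<exists>n\<ge>m. Q k n \<subseteq> C) \<and> (\<exists>n\<ge>m. Q k n \<inter> C = {})"
      by (rule greedy_two_colouring)
    then obtain C where C: "\<forall>k m. (\<exists>n\<ge>m. Q k n \<subseteq> C) \<and> (\<exists>n\<ge>m. Q k n \<inter> C = {})" ..
    have "(\<exists>n. f n \<in> X \<inter> C) \<and> (\<exists>n. f n \<in> X - C)" if f: "f \<in> F" "finite {n. f n \<notin> X}" for f
    proof -
      obtain i j where ij: "i \<noteq> j" "f i \<in> X" "f j \<in> X" using two f by blast
      then have "(i, j, f i, f j) \<in> T" by (simp add: T_def)
      then obtain k where k: "from_nat_into T k = (i, j, f i, f j)"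
        using from_nat_into_surj[OF T] by blast
      from f(2) obtain m where "\<forall>n\<in>{n. f n \<notin> X}. n < m"
        unfolding finite_nat_set_iff_bounded ..
      then have m: "f n \<in> X" if "n \<ge> m" for n
        using that by force
      have Q: "f n \<in> Q k n" for n
        using ij f by (auto simp: Q_def k)
      show ?thesis
      proof
        obtain n where "n \<ge> m" "Q k n \<subseteq> C" using C by blast
        then show "\<exists>n. f n \<in> X \<inter> C" using m[of n] Q[of n] by blast
      next
        obtain n where "n \<ge> m" "Q k n \<inter> C = {}" using C by blast
        then show "\<exists>n. f n \<in> X - C" using m[of n] Q[of n] by blast
      qed
    qed
    then show ?thesis by blast
  next
    case False
    then have inf: "infinite X" using countable_finite by blast
    have nat: "|UNIV :: nat set| <o |X|"
    proof -
      have "\<not> |X| \<le>o |UNIV :: nat set|"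
        using False card_of_ordLeq[of X "UNIV :: nat set"] by (auto simp: countable_def)
      then show ?thesis
        by (rule not_ordLeq_iff_ordLess[OF card_of_Well_order card_of_Well_order, THEN iffD1])
    qed
    \<comment> \<open>All values of sequences that take the values \<open>a\<close> and
      \<open>b\<close> at two distinct positions.\<close>
    define P where
      "P a b = (\<Union>i. \<Union>j\<in>- {i}. \<Union>n. {f n |f. f \<in> F \<and> f i = a \<and> f j = b})" for a b
    have P: "countable (P a b)" for a b
      unfolding P_def by (intro countable_UN countableI_type countable_finite fin) auto
    \<comment> \<open>Each hull of an initial segment contains every option given by two of its
      points. For empty \<open>P a b\<close> the enumeration yields an arbitrary point, which only
      enlarges the hull.\<close>
    define G where "G b = generated (\<lambda>a b. from_nat_into (P a b)) (under |X| b)" for b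
    have G_closed: "f n \<in> G b" if "f \<in> F" "i \<noteq> j" "f i \<in> G b" "f j \<in> G b" for f i j n b
    proof -
      have "f n \<in> {g n |g. g \<in> F \<and> g i = f i \<and> g j = f j}" using that(1) by blast
      then have "f n \<in> P (f i) (f j)" unfolding P_def using that(2) by (intro UN_I) auto
      then obtain k where "from_nat_into (P (f i) (f j)) k = f n"
        using from_nat_into_surj[OF P] by blast
      then show ?thesis
        using generated_closed[OF that(3,4)[unfolded G_def], of k] by (simp add: G_def)
    qed
    have "Well_order |X|" by (rule card_of_Well_order)
    then have lin: "Linear_order |X|" and wf: "wf ( |X| - Id)"
      by (auto simp: well_order_on_def)
    then have tr: "trans |X|" and refl: "refl_on X |X|" and tot: "total_on X |X|"
      by (auto simp: order_on_defs Field_card_of)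
    have lin_le: "(b, c) \<in> |X| \<or> (c, b) \<in> |X|" if "b \<in> X" "c \<in> X" for b c
      using refl tot that by (cases "b = c") (auto simp: refl_on_def total_on_def)
    have G_mono: "G b \<subseteq> G c" if "(b, c) \<in> |X|" for b c
      unfolding G_def using that tr by (intro generated_mono) (auto simp: under_def dest: transD)
    have G_self: "b \<in> G b" if "b \<in> X" for b
      using generated_base refl_onD[OF refl that] unfolding G_def under_def by fast
    \<comment> \<open>Since \<open>|X|\<close> is a cardinal order, its initial segments are smaller
      than \<open>X\<close>; as \<open>X\<close> is uncountable, they stay smaller after adding a
      copy of \<open>nat\<close>.\<close>
    have G_card: "|G b| <o |X|" if "b \<in> X" for b
    proof -
      have "under |X| b \<subseteq> underS |X| b \<union> {b}" by (auto simp: under_def underS_def)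
      then have "|under |X| b| \<le>o |underS |X| b \<union> {b}|" by (rule card_of_mono1)
      also have "|underS |X| b \<union> {b}| \<le>o |underS |X| b <+> {b}|" by (rule card_of_Un_Plus_ordLeq)
      also have "|underS |X| b <+> {b}| <o |X|"
        using that inf
        by (intro card_of_Plus_ordLess_infinite card_of_underS card_of_Card_order
            finite_ordLess_infinite card_of_Well_order) (simp_all add: Field_card_of)
      finally have "|under |X| b <+> (UNIV :: nat set)| <o |X|"
        using nat inf by (intro card_of_Plus_ordLess_infinite)
      then show ?thesis
        unfolding G_def using card_of_generated ordLeq_ordLess_trans by blast
    qed
    text \<open>The members \<open>G b\<close> of the chain need not be subsets of \<open>X\<close>.\<close>
    define L where "L b = X \<inter> G b - (\<Union>c\<in>underS |X| b. G c)" for b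
    have "\<exists>C. \<forall>f\<in>F. finite {n. f n \<notin> L b} \<longrightarrow> (\<exists>n. f n \<in> L b \<inter> C) \<and> (\<exists>n. f n \<in> L b - C)"
      if "b \<in> X" for b
    proof (rule "1.IH")
      have "|L b| \<le>o |G b|" by (rule card_of_mono1) (auto simp: L_def)
      then show "(L b, X) \<in> inv_image ordLess card_of"
        using G_card[OF that] ordLeq_ordLess_trans by auto
    qed
    then obtain K where K: "\<And>b f. \<lbrakk>b \<in> X; f \<in> F; finite {n. f n \<notin> L b}\<rbrakk> \<Longrightarrow>
        (\<exists>n. f n \<in> L b \<inter> K b) \<and> (\<exists>n. f n \<in> L b - K b)"
      by metis
    have L_disj: "L b \<inter> L c = {}" if "b \<in> X" "c \<in> X" "b \<noteq> c" for b c
      using lin_le[of b c] that unfolding L_def underS_def by auto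
    \<comment> \<open>The pieces \<open>L b\<close> are disjoint, so their colourings combine
      without conflict.\<close>
    define C where "C = (\<Union>b\<in>X. L b \<inter> K b)"
    have C_L: "x \<in> C \<longleftrightarrow> x \<in> K b" if "b \<in> X" "x \<in> L b" for x b
      using L_disj that unfolding C_def by blast
    have "(\<exists>n. f n \<in> X \<inter> C) \<and> (\<exists>n. f n \<in> X - C)" if f: "f \<in> F" "finite {n. f n \<notin> X}" for f
    proof -
      \<comment> \<open>Two terms in \<open>G b\<close> force the whole sequence into
        \<open>G b\<close>; the least such \<open>b\<close> selects the piece to use.\<close>
      define U where "U = {b \<in> X. \<exists>i j. i \<noteq> j \<and> f i \<in> X \<inter> G b \<and> f j \<in> X \<inter> G b}"
      have U: "b \<in> U \<or> c \<in> U"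
        if "i \<noteq> j" "f i \<in> X \<inter> G b" "f j \<in> X \<inter> G c" "b \<in> X" "c \<in> X" for i j b c
        using lin_le[OF that(4,5)] G_mono[of b c] G_mono[of c b] that unfolding U_def by blast
      obtain i j where "i \<noteq> j" "f i \<in> X" "f j \<in> X" using two f by blast
      then have "U \<noteq> {}" using U[of i j "f i" "f j"] G_self by blast
      then obtain b where b: "b \<in> U" and min: "\<And>c. (c, b) \<in> |X| - Id \<Longrightarrow> c \<notin> U"
        using wfE_min[OF wf] by (metis ex_in_conv)
      have bX: "b \<in> X" using b by (simp add: U_def)
      have G: "f n \<in> G b" for n using b G_closed[OF f(1)] unfolding U_def by blast
      define E where "E = {n. f n \<in> X \<and> (\<exists>c\<in>underS |X| b. f n \<in> G c)}"
      \<comment> \<open>Two terms in earlier members of the chain would both lie in the later of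
        these, against the minimality of \<open>b\<close>.\<close>
      have "i = j" if "i \<in> E" "j \<in> E" for i j
      proof (rule ccontr)
        assume "i \<noteq> j"
        moreover obtain c d where "c \<in> underS |X| b" "f i \<in> G c" "d \<in> underS |X| b" "f j \<in> G d"
          using \<open>i \<in> E\<close> \<open>j \<in> E\<close> unfolding E_def by blast
        moreover have "c \<in> X" "d \<in> X"
          using calculation by (auto simp: underS_def dest: FieldI1 simp: Field_card_of)
        ultimately have "c \<in> U \<or> d \<in> U"
          using U[of i j c d] that unfolding E_def by blast
        then show False
          using min \<open>c \<in> underS |X| b\<close> \<open>d \<in> underS |X| b\<close> unfolding underS_def by blast
      qed
      then have "finite E" by (metis finite.simps finite_subset insertCI subsetI)
      moreover have "{n. f n \<notin> L b} \<subseteq> {n. f n \<notin> X} \<union> E"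
        using G unfolding L_def E_def by blast
      ultimately have "finite {n. f n \<notin> L b}"
        using f(2) by (meson finite_UnI finite_subset)
      from K[OF bX f(1) this] obtain m n where "f m \<in> L b \<inter> K b" "f n \<in> L b - K b" by blast
      moreover have "L b \<subseteq> X" by (auto simp: L_def)
      ultimately show ?thesis using C_L[OF bX] by blast
    qed
    then show ?thesis by blast
  qed
qed

corollary two_colouring_of_sequences:
  fixes F :: "(nat \<Rightarrow> 'a) set"
  assumes "\<And>i j a b n. i \<noteq> j \<Longrightarrow> finite {f n |f. f \<in> F \<and> f i = a \<and> f j = b}"
    and "\<And>i j a b c. i \<noteq> j \<Longrightarrow> finite {n. \<exists>f\<in>F. f i = a \<and> f j = b \<and> f n = c}"
  shows "\<exists>C. \<forall>f\<in>F. (\<exists>n. f n \<in> C) \<and> (\<exists>n. f n \<notin> C)"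
  using two_colouring_of_sequences_on[OF assms, of UNIV] by simp

section \<open>The chromatic number of an infinite set\<close>

text \<open>Both finiteness conditions come from pairs of circles: \<open>f n\<close> lies on
  circles around \<open>a\<close> and \<open>b\<close>, and if \<open>f n = c\<close> then
  \<open>x n\<close> lies on circles around \<open>x i\<close> and \<open>x j\<close>. Injectivity
  of \<open>x\<close> turns finitely many points into finitely many indices.\<close>

lemma (in strictly_convex_plane) two_colouring_isometric_sequences:
  assumes x: "inj (x :: nat \<Rightarrow> real ^ 2)"
  defines "F \<equiv> {f. \<forall>i j. N (f i - f j) = N (x i - x j)}"
  shows "\<exists>C. \<forall>f\<in>F. (\<exists>n. f n \<in> C) \<and> (\<exists>n. f n \<notin> C)"
proof (rule two_colouring_of_sequences)
  have N0: "N 0 = 0" using scale[of 0 0] by simp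
  have iso: "N (f i - f j) = N (x i - x j)" if "f \<in> F" for f i j
    using that unfolding F_def by simp
  fix i j :: nat and a b
  assume "i \<noteq> j"
  then have xij: "x i \<noteq> x j" using x by (simp add: inj_eq)
  show "finite {f n |f. f \<in> F \<and> f i = a \<and> f j = b}" for n
  proof (cases "a = b")
    case True
    have ne: "f i \<noteq> f j" if "f \<in> F" for f
      using iso[OF that, of i j] pos[of "x i - x j"] xij N0 by auto
    then have "{f n |f. f \<in> F \<and> f i = a \<and> f j = b} = {}"
      using True by (auto dest: ne)
    then show ?thesis by (simp only: finite.emptyI)
  next
    case False
    have "{f n |f. f \<in> F \<and> f i = a \<and> f j = b} \<subseteq>
        {z. N (z - a) = N (x n - x i) \<and> N (z - b) = N (x n - x j)}"
      by (clarify, intro conjI iso)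
    then show ?thesis using finite_circle_Int[OF False] by (rule finite_subset)
  qed
  show "finite {n. \<exists>f\<in>F. f i = a \<and> f j = b \<and> f n = c}" for c
  proof (rule finite_subset)
    let ?S = "{z. N (z - x i) = N (c - a) \<and> N (z - x j) = N (c - b)}"
    show "{n. \<exists>f\<in>F. f i = a \<and> f j = b \<and> f n = c} \<subseteq> x -` ?S"
      by (clarsimp simp: iso)
    show "finite (x -` ?S)" by (rule finite_vimageI[OF finite_circle_Int[OF xij] x])
  qed
qed

text \<open>Composing an isometry of \<open>M\<close> with an injective sequence in \<open>M\<close>
  gives an isometric sequence inside the copy. The colours are arbitrary so that both numbers and
  truth values can serve.\<close>

lemma two_colouring_avoids_copies:
  fixes u v :: 'c
  assumes p: "1 < p" and M: "infinite M" and uv: "u \<noteq> v"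
  obtains c :: "real ^ 2 \<Rightarrow> 'c" where "range c \<subseteq> {u, v}" "avoids_monochromatic_copies p M c"
proof -
  interpret strictly_convex_plane "lp_norm p"
    using p by (rule strictly_convex_plane_lp_norm)
  obtain x :: "nat \<Rightarrow> real ^ 2" where x: "inj x" "range x \<subseteq> M"
    using M infinite_countable_subset by blast
  from two_colouring_isometric_sequences[OF x(1)] obtain C where
    C: "\<forall>f\<in>{f. \<forall>i j. lp_norm p (f i - f j) = lp_norm p (x i - x j)}.
      (\<exists>n. f n \<in> C) \<and> (\<exists>n. f n \<notin> C)" ..
  let ?c = "\<lambda>z. if z \<in> C then u else v"
  have "avoids_monochromatic_copies p M ?c"
    unfolding avoids_monochromatic_copies_def
  proof clarify
    fix M'
    assume "lp_isometric_copy p M M'" and mono: "monochromatic ?c M'"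
    then obtain f where f: "bij_betw f M M'"
      "\<forall>x\<in>M. \<forall>y\<in>M. lp_norm p (x - y) = lp_norm p (f x - f y)"
      by (auto simp: lp_isometric_copy_def)
    have xM: "x i \<in> M" for i using x(2) by blast
    have "f \<circ> x \<in> {f. \<forall>i j. lp_norm p (f i - f j) = lp_norm p (x i - x j)}"
      using f(2) xM by simp
    from bspec[OF C this] obtain m n where "f (x m) \<in> C" "f (x n) \<notin> C"
      unfolding comp_def by blast
    moreover have "f (x k) \<in> M'" for k
      using f(1) xM by (rule bij_betw_apply)
    ultimately show False
      using mono uv unfolding monochromatic_def by metis
  qed
  then show ?thesis
    by (intro that[of ?c]) auto
qed

lemma lp_isometric_copy_refl: "lp_isometric_copy p M M"
  unfolding lp_isometric_copy_def by (intro exI[of _ id]) auto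

theorem theorem1:
  fixes p :: real and M :: "(real ^ 2) set"
  assumes "1 < p" and "infinite M"
  shows "lp_chromatic_number p M = 2 \<and>
         (\<exists>c :: real ^ 2 \<Rightarrow> bool. avoids_monochromatic_copies p M c)"
proof
  let ?K = "{enat k | k. \<exists>c :: real ^ 2 \<Rightarrow> nat. range c \<subseteq> {..<k} \<and> avoids_monochromatic_copies p M c}"
  obtain c :: "real ^ 2 \<Rightarrow> nat" where c: "range c \<subseteq> {0, 1}" "avoids_monochromatic_copies p M c"
    using two_colouring_avoids_copies[OF assms zero_neq_one] .
  have "range c \<subseteq> {..<2}" using c(1) by (rule subset_trans) simp
  with c(2) have "enat 2 \<in> ?K" by blast
  moreover have "enat 2 \<le> e" if e: "e \<in> ?K" for e
  proof -
    obtain k and c :: "real ^ 2 \<Rightarrow> nat" where k: "e = enat k" "range c \<subseteq> {..<k}"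
      "avoids_monochromatic_copies p M c"
      using e unfolding mem_Collect_eq by (elim exE conjE)
    \<comment> \<open>With fewer than two colours a colouring is constant, and \<open>M\<close> is a
      monochromatic copy of itself.\<close>
    have "2 \<le> k"
    proof (rule ccontr)
      assume "\<not> 2 \<le> k"
      then have "c z = 0" for z
        using subsetD[OF k(2) rangeI[of c z]] by simp
      then have "monochromatic c M" by (simp add: monochromatic_def)
      then show False
        using k(3) lp_isometric_copy_refl[of p M] unfolding avoids_monochromatic_copies_def by blast
    qed
    then show ?thesis by (simp add: k(1))
  qed
  ultimately have "Inf ?K = enat 2"
    by (intro antisym Inf_lower Inf_greatest)
  then show "lp_chromatic_number p M = 2"
    by (simp add: lp_chromatic_number_def numeral_eq_enat)
  show "\<exists>c :: real ^ 2 \<Rightarrow> bool. avoids_monochromatic_copies p M c"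
    by (rule two_colouring_avoids_copies[OF assms True_not_False]) (rule exI)
qed

end
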